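(* Let $\mathcal{M}$ be a Riemannian manifold with a fixed retraction $R:T\mathcal{M}\to\mathcal{M}$, let $\Omega$ be a non-empty set, and let $H:\mathcal{M}\times\Omega\to T\mathcal{M}$ be a function such that $H(\bullet,\omega)$ is a tangent vector field on $\mathcal{M}$ for every $\omega\in\Omega$, and $H$ is locally bounded, i.e. for every compact $K\subset\mathcal{M}$ there is an $r>0$ depending on $K$ such that $\|H(x,\omega)\|_x\le r$ for all $(x,\omega)\in K\times\Omega$. For $x\in\mathcal{M}$ let $C_x$ be the convex hull of $\{H(x,\omega):\omega\in\Omega\}$ in $T_x\mathcal{M}$. 1. Assume further that: (a) $\rho$ is a confinement of $H$, and $\rho_0\in\mathbb{R}$ satisfies $\langle\nabla\rho(x),H(x,\omega)\rangle_x\ge0$ for all $\omega\in\Omega$ and all $x\in\mathcal{M}$ with $\rho(x)\ge\rho_0$; (b) $\{\gamma_t\}_{t=0}^\infty$ is a sequence of positive numbers with $\sum_{t=0}^\infty\gamma_t^2<\infty$ and $\sum_{t=0}^\infty\gamma_t=\infty$; (c) $\lambda,b,\Theta$ are positive constants, $c=\max\{\gamma_t: t\ge0\}$, $\sigma=\sum_{t=0}^\infty\gamma_t^2$ and $\rho_1=\rho_0+\lambda c+\frac{b^2\sigma}{2}$; (d) $\varphi$ is a positive constant with $\varphi\ge\max\{\Lambda,B,\frac{c}{\Theta}\}$, where $$\Lambda=\frac1\lambda\sup\left\{\max\{0,-\langle\nabla\rho(x),\mathbf{v}\rangle_x\} : \rho(x)\le\rho_0,\ \mathbf{v}\in C_x\right\},$$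 $$B=\frac1b\sup\left\{\sqrt{\max\{0,\mathrm{Hess}(\rho\circ R_x)|_{-\theta\mathbf{v}}(\mathbf{v},\mathbf{v})\}} : 0\le\theta\le\Theta,\ \rho(x)\le\rho_1,\ \mathbf{v}\in C_x\right\};$$ (e) the sequences $\{x_t\}_{t=0}^\infty\subset\mathcal{M}$ and $\{\mathbf{u}_t\in C_{x_t}\}_{t=0}^\infty$ satisfy $\rho(x_0)\le\rho_0$ and $x_{t+1}=R_{x_t}\left(-\frac{\gamma_t}{\varphi}\mathbf{u}_t\right)$ for $t\ge0$. Then $\{x_t\}_{t=0}^\infty$ is contained in the compact set $\{x\in\mathcal{M}:\rho(x)\le\rho_1\}$. 2. Assume instead further that: (a) $\rho$ is a batch $\kappa$-confinement of $H$ for some $\kappa>0$; (b) $\rho_0<\rho_1$ are real numbers such that, for all $s\in[0,\kappa]$, $x\in\mathcal{M}$ and $\mathbf{v}\in C_x$: if $\rho(x)\le\rho_0$ then $\rho(R_x(-s\mathbf{v}))\le\rho_1$; and if $\rho_0\le\rho(x)\le\rho_1$ then $\langle\nabla\rho(x),\mathbf{v}\rangle_x\ge\max\left\{0,\frac\kappa2\mathrm{Hess}(\rho\circ R_x)|_{-s\mathbf{v}}(\mathbf{v},\mathbf{v})\right\}$; (c) $\{\eta_t\}_{t=0}^\infty$ satisfies $0<\eta_t\le\kappa$ for $t\ge0$; (d) the sequences $\{x_t\}_{t=0}^\infty\subset\mathcal{M}$ and $\{\mathbf{u}_t\in C_{x_t}\}_{t=0}^\infty$ satisfy $\rho(x_0)\le\rho_1$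 and $x_{t+1}=R_{x_t}(-\eta_t\mathbf{u}_t)$ for $t\ge0$. Then $\{x_t\}_{t=0}^\infty$ is contained in the compact set $\{x\in\mathcal{M}:\rho(x)\le\rho_1\}$.
   Context: Retraction: a $C^2$ map $R:T\mathcal{M}\to\mathcal{M}$ such that for every $x\in\mathcal{M}$ the restriction $R_x=R|_{T_x\mathcal{M}}$ satisfies $R_x(\mathbf{0}_x)=x$ and $dR_x(\mathbf{0}_x)=\mathrm{id}_{T_x\mathcal{M}}$ (under the standard identification $T_{\mathbf{0}_x}T_x\mathcal{M}\cong T_x\mathcal{M}$). $\langle\cdot,\cdot\rangle_x$ and $\|\cdot\|_x$ are the Riemannian inner product and norm on $T_x\mathcal{M}$, and $\nabla$ is the Riemannian gradient. $\mathrm{Hess}(\rho\circ R_x)$ is the Hessian of the function $\rho\circ R_x:T_x\mathcal{M}\to\mathbb{R}$ defined on the inner product space $T_x\mathcal{M}$; $\mathrm{Hess}(\rho\circ R_x)|_{\mathbf{w}}(\mathbf{v},\mathbf{v})$ is its value at the point $\mathbf{w}\in T_x\mathcal{M}$ as a bilinear form. Confinement: a confinement of $H$ on $\mathcal{M}$ is a $C^2$ function $\rho:\mathcal{M}\to\mathbb{R}$ such that (i) for every $c\in\mathbb{R}$ the set $\{x\in\mathcal{M}:\rho(x)\le c\}$ is compact, and (ii) there exists $\rho_0\in\mathbb{R}$ such that $\langle\nabla\rho(x),H(x,\omega)\rangle_x\ge0$ for all $\omega\in\Omega$ and all $x\in\mathcal{M}$ with $\rho(x)\ge\rho_0$. Batch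 $\kappa$-confinement: for fixed $\kappa>0$, a batch $\kappa$-confinement of $H$ on $\mathcal{M}$ is a $C^2$ function $\rho:\mathcal{M}\to\mathbb{R}$ such that (i) for every $c\in\mathbb{R}$ the set $\{x\in\mathcal{M}:\rho(x)\le c\}$ is compact, and (ii) there exist $\rho_0<\rho_1$ in $\mathbb{R}$ such that, for all $s\in[0,\kappa]$, $x\in\mathcal{M}$ and $\mathbf{v}\in C_x$ (the convex hull of $\{H(x,\omega):\omega\in\Omega\}$): if $\rho(x)\le\rho_0$ then $\rho(R_x(-s\mathbf{v}))\le\rho_1$; if $\rho_0\le\rho(x)\le\rho_1$ then $\langle\nabla\rho(x),\mathbf{v}\rangle_x\ge\max\{0,\frac\kappa2\mathrm{Hess}(\rho\circ R_x)|_{-s\mathbf{v}}(\mathbf{v},\mathbf{v})\}$. *)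

theory Defs
  imports "HOL-Analysis.Analysis" "HOL-Library.Function_Algebras"
begin

text \<open>Pointwise real vector space structure on functions; it makes the library's \<open>convex hull\<close> and
  \<open>subspace\<close> available for tangent vectors, which are families of components indexed by charts.\<close>

instantiation "fun" :: (type, real_vector) real_vector
begin

definition scaleR_fun_def: "r *\<^sub>R f = (\<lambda>x. r *\<^sub>R f x)"

instance
  by standard
    (simp_all add: scaleR_fun_def fun_eq_iff plus_fun_def scaleR_add_right scaleR_add_left)

end


section \<open>Functions of class \<open>C\<^sup>k\<close> between vector spaces\<close>

text \<open>Only used for open \<open>S\<close> and a finite-dimensional domain, where asking for \<open>C\<^sup>k\<close> directional
  derivatives in every direction is the usual recursive definition of \<open>C\<^sup>k\<^sup>+\<^sup>1\<close>.\<close>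

primrec Ck_on :: "nat \<Rightarrow> 'a::real_normed_vector set \<Rightarrow> ('a \<Rightarrow> 'b::real_normed_vector) \<Rightarrow> bool" where
  "Ck_on 0 S f \<longleftrightarrow> continuous_on S f"
| "Ck_on (Suc k) S f \<longleftrightarrow> (\<forall>x\<in>S. f differentiable (at x)) \<and>
     (\<forall>v. Ck_on k S (\<lambda>x. frechet_derivative f (at x) v))"


section \<open>Smooth manifolds\<close>

text \<open>A manifold is given by an atlas on a set of points (the union of the chart domains), its topology
  being the one induced by the atlas. A chart is a pair of its domain and its coordinate map.\<close>

type_synonym ('m, 'e) chart = "'m set \<times> ('m \<Rightarrow> 'e)"

abbreviation cdom :: "('m, 'e) chart \<Rightarrow> 'm set" where "cdom \<equiv> fst"
abbreviation cmap :: "('m, 'e) chart \<Rightarrow> 'm \<Rightarrow> 'e" where "cmap \<equiv> snd"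

definition cinv :: "('m, 'e) chart \<Rightarrow> 'e \<Rightarrow> 'm" where
  "cinv c = inv_into (cdom c) (cmap c)"

definition points :: "('m, 'e) chart set \<Rightarrow> 'm set" where
  "points A = (\<Union>c\<in>A. cdom c)"

definition charts_at :: "('m, 'e) chart set \<Rightarrow> 'm \<Rightarrow> ('m, 'e) chart set" where
  "charts_at A x = {c \<in> A. x \<in> cdom c}"

definition open_set :: "('m, 'e::topological_space) chart set \<Rightarrow> 'm set \<Rightarrow> bool" where
  "open_set A W \<longleftrightarrow> W \<subseteq> points A \<and> (\<forall>c\<in>A. open (cmap c ` (W \<inter> cdom c)))"

definition manifold_topology :: "('m, 'e::topological_space) chart set \<Rightarrow> 'm topology" where
  "manifold_topology A = topology (open_set A)"

text \<open>The model space is a finite-dimensional inner product space rather than a type of class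
  \<open>euclidean_space\<close>, which would exclude dimension zero.\<close>

locale smooth_manifold =
  fixes A :: "('m, 'e::real_inner) chart set"
  assumes finite_dim: "\<exists>B :: 'e set. finite B \<and> span B = UNIV"
    and chart_inj: "c \<in> A \<Longrightarrow> inj_on (cmap c) (cdom c)"
    and chart_open: "c \<in> A \<Longrightarrow> d \<in> A \<Longrightarrow> open (cmap c ` (cdom c \<inter> cdom d))"
    and chart_smooth: "c \<in> A \<Longrightarrow> d \<in> A \<Longrightarrow>
      Ck_on k (cmap c ` (cdom c \<inter> cdom d)) (cmap d \<circ> cinv c)"
    and Hausdorff: "Hausdorff_space (manifold_topology A)"
    and second_countable: "second_countable (manifold_topology A)"
begin

lemma openin_manifold_topology: "openin (manifold_topology A) W \<longleftrightarrow> open_set A W"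
proof -
  have "open_set A (S \<inter> T)" if "open_set A S" "open_set A T" for S T
    unfolding open_set_def
  proof (intro conjI ballI)
    show "S \<inter> T \<subseteq> points A" using that by (auto simp: open_set_def)
    fix c assume c: "c \<in> A"
    have "cmap c ` ((S \<inter> T) \<inter> cdom c) = cmap c ` (S \<inter> cdom c) \<inter> cmap c ` (T \<inter> cdom c)"
      using chart_inj[OF c] by (auto simp: inj_on_def)
    then show "open (cmap c ` ((S \<inter> T) \<inter> cdom c))"
      using that c by (auto simp: open_set_def)
  qed
  moreover have "open_set A (\<Union>\<K>)" if "\<And>K. K \<in> \<K> \<Longrightarrow> open_set A K" for \<K>
    unfolding open_set_def
  proof (intro conjI ballI)
    show "\<Union>\<K> \<subseteq> points A" using that by (auto simp: open_set_def)
    fix c assume c: "c \<in> A"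
    have "cmap c ` (\<Union>\<K> \<inter> cdom c) = (\<Union>K\<in>\<K>. cmap c ` (K \<inter> cdom c))"
      by auto
    then show "open (cmap c ` (\<Union>\<K> \<inter> cdom c))"
      using that c by (auto simp: open_set_def)
  qed
  ultimately have "istopology (open_set A)"
    by (auto simp: istopology_def)
  then show ?thesis
    by (simp add: manifold_topology_def topology_inverse')
qed

end

text \<open>\<open>C\<^sup>k\<close> maps between manifolds. Openness of the chart domains of \<open>f\<close> together with continuity of
  its coordinate representations amounts to continuity of \<open>f\<close>.\<close>

definition Ck_map :: "nat \<Rightarrow> ('m, 'e::real_normed_vector) chart set \<Rightarrow>
    ('n, 'f::real_normed_vector) chart set \<Rightarrow> ('m \<Rightarrow> 'n) \<Rightarrow> bool" where
  "Ck_map k A B f \<longleftrightarrow> f ` points A \<subseteq> points B \<and>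
     (\<forall>c\<in>A. \<forall>d\<in>B. open (cmap c ` (cdom c \<inter> f -` cdom d)) \<and>
        Ck_on k (cmap c ` (cdom c \<inter> f -` cdom d)) (cmap d \<circ> f \<circ> cinv c))"

definition standard_atlas :: "('e, 'e) chart set" where
  "standard_atlas = {(UNIV, id)}"


section \<open>Tangent vectors\<close>

text \<open>A tangent vector at \<open>x\<close> is the family of its components with respect to the charts at \<open>x\<close>,
  transforming by the derivatives of the transition maps; the entries at other charts are zero.\<close>

type_synonym ('m, 'e) tvec = "('m, 'e) chart \<Rightarrow> 'e"

definition tangent_space ::
    "('m, 'e::real_normed_vector) chart set \<Rightarrow> 'm \<Rightarrow> ('m, 'e) tvec set" where
  "tangent_space A x = {v.
     (\<forall>c. c \<notin> charts_at A x \<longrightarrow> v c = 0) \<and>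
     (\<forall>c\<in>charts_at A x. \<forall>d\<in>charts_at A x.
        v d = frechet_derivative (cmap d \<circ> cinv c) (at (cmap c x)) (v c))}"

text \<open>The tangent vector at \<open>x\<close> with components \<open>a\<close> in the chart \<open>c\<close>; for \<open>c\<close> a chart at \<open>x\<close> this is
  the linear isomorphism from the model space onto the tangent space inverse to \<open>\<lambda>v. v c\<close>.\<close>

definition tvec_of ::
    "('m, 'e::real_normed_vector) chart set \<Rightarrow> ('m, 'e) chart \<Rightarrow> 'm \<Rightarrow> 'e \<Rightarrow> ('m, 'e) tvec" where
  "tvec_of A c x a = (\<lambda>d. if d \<in> charts_at A x
     then frechet_derivative (cmap d \<circ> cinv c) (at (cmap c x)) a else 0)"

definition tangent_atlas :: "('m, 'e::real_normed_vector) chart set \<Rightarrow>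
    ('m \<times> ('m, 'e) tvec, 'e \<times> 'e) chart set" where
  "tangent_atlas A =
     (\<lambda>c. (Sigma (cdom c) (tangent_space A), \<lambda>(x, v). (cmap c x, v c))) ` A"

text \<open>Differential \<open>d\<rho>\<^sub>x(v)\<close>, computed in an arbitrary chart at \<open>x\<close>.\<close>

definition differential ::
    "('m, 'e::real_normed_vector) chart set \<Rightarrow> ('m \<Rightarrow> real) \<Rightarrow> 'm \<Rightarrow> ('m, 'e) tvec \<Rightarrow> real" where
  "differential A \<rho> x v = (let c = (SOME c. c \<in> charts_at A x)
     in frechet_derivative (\<rho> \<circ> cinv c) (at (cmap c x)) (v c))"

text \<open>Hessian at \<open>w\<close>, as a bilinear form, of a function \<open>f\<close> on the vector space \<open>tangent_space A x\<close>: the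
  second derivative of \<open>f\<close>, the tangent space being identified with the model space by the linear
  isomorphism given by an arbitrary chart at \<open>x\<close>. As \<open>tangent_space A x\<close> is flat, neither that chart
  nor the inner product influences this bilinear form.\<close>

definition tangent_hessian :: "('m, 'e::real_normed_vector) chart set \<Rightarrow> 'm \<Rightarrow>
    (('m, 'e) tvec \<Rightarrow> real) \<Rightarrow> ('m, 'e) tvec \<Rightarrow> ('m, 'e) tvec \<Rightarrow> ('m, 'e) tvec \<Rightarrow> real" where
  "tangent_hessian A x f w u v = (let c = (SOME c. c \<in> charts_at A x)
     in frechet_derivative
          (\<lambda>a. frechet_derivative (f \<circ> tvec_of A c x) (at a) (v c)) (at (w c)) (u c))"


section \<open>Riemannian manifolds and retractions\<close>

type_synonym ('m, 'e) metric_tensor = "'m \<Rightarrow> ('m, 'e) tvec \<Rightarrow> ('m, 'e) tvec \<Rightarrow> real"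

locale riemannian_manifold = smooth_manifold A
  for A :: "('m, 'e::real_inner) chart set" +
  fixes g :: "('m, 'e) metric_tensor"
  assumes metric_sym: "x \<in> points A \<Longrightarrow> u \<in> tangent_space A x \<Longrightarrow> v \<in> tangent_space A x \<Longrightarrow>
      g x u v = g x v u"
    and metric_add: "x \<in> points A \<Longrightarrow> u \<in> tangent_space A x \<Longrightarrow> v \<in> tangent_space A x \<Longrightarrow>
      w \<in> tangent_space A x \<Longrightarrow> g x (u + v) w = g x u w + g x v w"
    and metric_scale: "x \<in> points A \<Longrightarrow> u \<in> tangent_space A x \<Longrightarrow> v \<in> tangent_space A x \<Longrightarrow>
      g x (r *\<^sub>R u) v = r * g x u v"
    and metric_pos: "x \<in> points A \<Longrightarrow> u \<in> tangent_space A x \<Longrightarrow> u \<noteq> 0 \<Longrightarrow> g x u u > 0"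
    and metric_smooth: "c \<in> A \<Longrightarrow> Ck_on k (cmap c ` cdom c)
      (\<lambda>y. g (cinv c y) (tvec_of A c (cinv c y) a) (tvec_of A c (cinv c y) b))"

definition metric_norm :: "('m, 'e) metric_tensor \<Rightarrow> 'm \<Rightarrow> ('m, 'e) tvec \<Rightarrow> real" where
  "metric_norm g x v = sqrt (g x v v)"

definition gradient :: "('m, 'e::real_normed_vector) chart set \<Rightarrow> ('m, 'e) metric_tensor \<Rightarrow>
    ('m \<Rightarrow> real) \<Rightarrow> 'm \<Rightarrow> ('m, 'e) tvec" where
  "gradient A g \<rho> x = (THE u. u \<in> tangent_space A x \<and>
     (\<forall>v\<in>tangent_space A x. g x u v = differential A \<rho> x v))"

text \<open>The last conjunct says \<open>dR\<^sub>x(0\<^sub>x) = id\<close>: with respect to the coordinates \<open>v \<mapsto> v c\<close> on the tangent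
  space and the chart \<open>c\<close> around \<open>x\<close>, both of which identify \<open>T\<^sub>xM\<close> with the model space.\<close>

definition manifold_retraction ::
    "('m, 'e::real_normed_vector) chart set \<Rightarrow> ('m \<Rightarrow> ('m, 'e) tvec \<Rightarrow> 'm) \<Rightarrow> bool" where
  "manifold_retraction A R \<longleftrightarrow>
     Ck_map 2 (tangent_atlas A) A (\<lambda>(x, v). R x v) \<and>
     (\<forall>x\<in>points A. R x 0 = x) \<and>
     (\<forall>x\<in>points A. \<forall>c\<in>charts_at A x.
        ((\<lambda>a. cmap c (R x (tvec_of A c x a))) has_derivative (\<lambda>a. a)) (at 0))"


section \<open>Families of vector fields and confinements\<close>

definition vector_field_family :: "('m, 'e::real_normed_vector) chart set \<Rightarrow> 'w set \<Rightarrow>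
    ('m \<Rightarrow> 'w \<Rightarrow> ('m, 'e) tvec) \<Rightarrow> bool" where
  "vector_field_family A \<Omega> H \<longleftrightarrow> (\<forall>x\<in>points A. \<forall>\<omega>\<in>\<Omega>. H x \<omega> \<in> tangent_space A x)"

definition locally_bounded :: "('m, 'e::real_normed_vector) chart set \<Rightarrow> ('m, 'e) metric_tensor \<Rightarrow>
    'w set \<Rightarrow> ('m \<Rightarrow> 'w \<Rightarrow> ('m, 'e) tvec) \<Rightarrow> bool" where
  "locally_bounded A g \<Omega> H \<longleftrightarrow> (\<forall>K. compactin (manifold_topology A) K \<longrightarrow>
     (\<exists>r>0. \<forall>x\<in>K. \<forall>\<omega>\<in>\<Omega>. metric_norm g x (H x \<omega>) \<le> r))"

definition hull_at :: "'w set \<Rightarrow> ('m \<Rightarrow> 'w \<Rightarrow> ('m, 'e::real_vector) tvec) \<Rightarrow> 'm \<Rightarrow>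
    ('m, 'e) tvec set" where
  "hull_at \<Omega> H x = convex hull ((\<lambda>\<omega>. H x \<omega>) ` \<Omega>)"

definition sublevel :: "('m, 'e) chart set \<Rightarrow> ('m \<Rightarrow> real) \<Rightarrow> real \<Rightarrow> 'm set" where
  "sublevel A \<rho> c = {x \<in> points A. \<rho> x \<le> c}"

definition confinement_level :: "('m, 'e::real_normed_vector) chart set \<Rightarrow>
    ('m, 'e) metric_tensor \<Rightarrow> 'w set \<Rightarrow> ('m \<Rightarrow> 'w \<Rightarrow> ('m, 'e) tvec) \<Rightarrow> ('m \<Rightarrow> real) \<Rightarrow> real \<Rightarrow> bool" where
  "confinement_level A g \<Omega> H \<rho> \<rho>0 \<longleftrightarrow>
     (\<forall>\<omega>\<in>\<Omega>. \<forall>x\<in>points A. \<rho> x \<ge> \<rho>0 \<longrightarrow> g x (gradient A g \<rho> x) (H x \<omega>) \<ge> 0)"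

definition confinement :: "('m, 'e::real_normed_vector) chart set \<Rightarrow>
    ('m, 'e) metric_tensor \<Rightarrow> 'w set \<Rightarrow> ('m \<Rightarrow> 'w \<Rightarrow> ('m, 'e) tvec) \<Rightarrow> ('m \<Rightarrow> real) \<Rightarrow> bool" where
  "confinement A g \<Omega> H \<rho> \<longleftrightarrow>
     Ck_map 2 A standard_atlas \<rho> \<and>
     (\<forall>c. compactin (manifold_topology A) (sublevel A \<rho> c)) \<and>
     (\<exists>\<rho>0. confinement_level A g \<Omega> H \<rho> \<rho>0)"

definition batch_levels :: "('m, 'e::real_normed_vector) chart set \<Rightarrow> ('m, 'e) metric_tensor \<Rightarrow>
    ('m \<Rightarrow> ('m, 'e) tvec \<Rightarrow> 'm) \<Rightarrow> 'w set \<Rightarrow> ('m \<Rightarrow> 'w \<Rightarrow> ('m, 'e) tvec) \<Rightarrow> real \<Rightarrow>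
    ('m \<Rightarrow> real) \<Rightarrow> real \<Rightarrow> real \<Rightarrow> bool" where
  "batch_levels A g R \<Omega> H \<kappa> \<rho> \<rho>0 \<rho>1 \<longleftrightarrow>
     (\<forall>s\<in>{0..\<kappa>}. \<forall>x\<in>points A. \<forall>v\<in>hull_at \<Omega> H x.
        (\<rho> x \<le> \<rho>0 \<longrightarrow> \<rho> (R x (- s *\<^sub>R v)) \<le> \<rho>1) \<and>
        (\<rho>0 \<le> \<rho> x \<and> \<rho> x \<le> \<rho>1 \<longrightarrow>
           g x (gradient A g \<rho> x) v
             \<ge> max 0 (\<kappa> / 2 * tangent_hessian A x (\<rho> \<circ> R x) (- s *\<^sub>R v) v v)))"

definition batch_confinement :: "('m, 'e::real_normed_vector) chart set \<Rightarrow>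
    ('m, 'e) metric_tensor \<Rightarrow> ('m \<Rightarrow> ('m, 'e) tvec \<Rightarrow> 'm) \<Rightarrow> 'w set \<Rightarrow>
    ('m \<Rightarrow> 'w \<Rightarrow> ('m, 'e) tvec) \<Rightarrow> real \<Rightarrow> ('m \<Rightarrow> real) \<Rightarrow> bool" where
  "batch_confinement A g R \<Omega> H \<kappa> \<rho> \<longleftrightarrow>
     Ck_map 2 A standard_atlas \<rho> \<and>
     (\<forall>c. compactin (manifold_topology A) (sublevel A \<rho> c)) \<and>
     (\<exists>\<rho>0 \<rho>1. \<rho>0 < \<rho>1 \<and> batch_levels A g R \<Omega> H \<kappa> \<rho> \<rho>0 \<rho>1)"

text \<open>The suprema \<open>\<Lambda>\<close> and \<open>B\<close> are taken in the extended reals, so that they are genuine suprema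
  without a prior proof of boundedness.\<close>

definition Lambda_bound :: "('m, 'e::real_normed_vector) chart set \<Rightarrow> ('m, 'e) metric_tensor \<Rightarrow>
    'w set \<Rightarrow> ('m \<Rightarrow> 'w \<Rightarrow> ('m, 'e) tvec) \<Rightarrow> ('m \<Rightarrow> real) \<Rightarrow> real \<Rightarrow> real \<Rightarrow> ereal" where
  "Lambda_bound A g \<Omega> H \<rho> \<rho>0 l = ereal (1 / l) *
     Sup {ereal (max 0 (- g x (gradient A g \<rho> x) v)) | x v.
       x \<in> points A \<and> \<rho> x \<le> \<rho>0 \<and> v \<in> hull_at \<Omega> H x}"

definition B_bound :: "('m, 'e::real_normed_vector) chart set \<Rightarrow>
    ('m \<Rightarrow> ('m, 'e) tvec \<Rightarrow> 'm) \<Rightarrow> 'w set \<Rightarrow> ('m \<Rightarrow> 'w \<Rightarrow> ('m, 'e) tvec) \<Rightarrow>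
    ('m \<Rightarrow> real) \<Rightarrow> real \<Rightarrow> real \<Rightarrow> real \<Rightarrow> ereal" where
  "B_bound A R \<Omega> H \<rho> \<rho>1 \<Theta> b = ereal (1 / b) *
     Sup {ereal (sqrt (max 0 (tangent_hessian A x (\<rho> \<circ> R x) (- \<theta> *\<^sub>R v) v v))) | \<theta> x v.
       0 \<le> \<theta> \<and> \<theta> \<le> \<Theta> \<and> x \<in> points A \<and> \<rho> x \<le> \<rho>1 \<and> v \<in> hull_at \<Omega> H x}"

end

theory Submission
  imports Defs
begin

text \<open>One step of the iteration goes from \<open>x\<close> to \<open>R\<^sub>x(-s v)\<close> with \<open>v\<close> in the convex hull at \<open>x\<close>. On the
  vector space \<open>T\<^sub>xM\<close> the function \<open>\<rho> \<circ> R\<^sub>x\<close> is twice differentiable, takes the value \<open>\<rho>(x)\<close> at \<open>0\<close> and,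
  as \<open>dR\<^sub>x(0) = id\<close>, has the derivative \<open>d\<rho>\<^sub>x = \<langle>\<nabla>\<rho>(x), \<cdot>\<rangle>\<^sub>x\<close> there. Taylor's formula along the segment
  from \<open>0\<close> to \<open>-s v\<close> therefore gives a \<open>\<theta>\<close> between \<open>0\<close> and \<open>s\<close> with

  \<open>\<rho>(R\<^sub>x(-s v)) = \<rho>(x) - s \<langle>\<nabla>\<rho>(x), v\<rangle>\<^sub>x + s\<^sup>2/2 Hess(\<rho> \<circ> R\<^sub>x)|\<^sub>-\<^sub>\<theta>\<^sub>v (v, v)\<close>

  (\<open>retraction_step_taylor\<close> and \<open>gradient_inner_eq_differential\<close>). Everything else is an estimate of the
  two correction terms.

  For a confinement, \<open>s = \<gamma>\<^sub>t/\<phi> \<le> c/\<phi> \<le> \<Theta>\<close>, so the bound \<open>B \<le> \<phi>\<close> covers the intermediate point and the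
  second-order term is at most \<open>b\<^sup>2 \<gamma>\<^sub>t\<^sup>2/2\<close>. The first-order term does not increase \<open>\<rho>\<close> where \<open>\<rho>(x) \<ge> \<rho>\<^sub>0\<close>,
  and where \<open>\<rho>(x) \<le> \<rho>\<^sub>0\<close> it adds at most \<open>l \<gamma>\<^sub>t \<le> l c\<close> because \<open>\<Lambda> \<le> \<phi>\<close>. The jump \<open>l c\<close> thus
  starts from \<open>\<rho>\<^sub>0\<close> each time it occurs and does not accumulate: only the second-order terms do, and
  \<open>\<rho>(x\<^sub>t) \<le> \<rho>\<^sub>0 + l c + b\<^sup>2/2 (\<gamma>\<^sub>0\<^sup>2 + \<dots> + \<gamma>\<^sub>t\<^sub>-\<^sub>1\<^sup>2)\<close> is preserved by every step
  (\<open>confinement_step\<close>, \<open>confined_iterates\<close>).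

  For a batch confinement, a step from \<open>\<rho>(x) \<le> \<rho>\<^sub>0\<close> ends below \<open>\<rho>\<^sub>1\<close> by assumption, and a step from the
  collar \<open>\<rho>\<^sub>0 \<le> \<rho>(x) \<le> \<rho>\<^sub>1\<close> does not increase \<open>\<rho>\<close>, because the first-order decrease dominates the
  second-order term (\<open>batch_confined_step\<close>).\<close>

section \<open>Twice differentiable maps\<close>

text \<open>The part of being \<open>C\<^sup>2\<close> that Taylor's formula with Lagrange remainder uses. Without continuity of
  the second derivatives the notion is pointwise in \<open>S\<close>, which makes local arguments immediate.\<close>

definition twice_diff_on ::
    "'a::real_normed_vector set \<Rightarrow> ('a \<Rightarrow> 'b::real_normed_vector) \<Rightarrow> bool" where
  "twice_diff_on S f \<longleftrightarrow> (\<forall>x\<in>S. f differentiable (at x)) \<and>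
     (\<forall>v. \<forall>x\<in>S. (\<lambda>y. frechet_derivative f (at y) v) differentiable (at x))"

lemma Ck_on_2_imp_twice_diff_on: "Ck_on 2 S f \<Longrightarrow> twice_diff_on S f"
  by (simp add: twice_diff_on_def numeral_2_eq_2)

lemma twice_diff_onD:
  assumes "twice_diff_on S f" "x \<in> S"
  shows "f differentiable (at x)"
    and "(f has_derivative frechet_derivative f (at x)) (at x)"
    and "(\<lambda>y. frechet_derivative f (at y) v) differentiable (at x)"
  using assms by (auto simp: twice_diff_on_def frechet_derivative_works[symmetric])

lemma differentiable_cong_open:
  assumes "f differentiable (at x)" "open U" "x \<in> U" "\<And>y. y \<in> U \<Longrightarrow> f y = g y"
  shows "g differentiable (at x)"
  using assms has_derivative_transform_within_open[of f _ x UNIV U g]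
  unfolding differentiable_def by blast

lemma twice_diff_onI:
  assumes U: "open U"
    and f': "\<And>x. x \<in> U \<Longrightarrow> (f has_derivative f' x) (at x)"
    and f'': "\<And>v x. x \<in> U \<Longrightarrow> (\<lambda>y. f' y v) differentiable (at x)"
  shows "twice_diff_on U f"
  unfolding twice_diff_on_def
proof (intro conjI allI ballI)
  show "f differentiable (at x)" if "x \<in> U" for x
    using f'[OF that] by (auto simp: differentiable_def)
  show "(\<lambda>y. frechet_derivative f (at y) v) differentiable (at x)" if x: "x \<in> U" for v x
    using frechet_derivative_at[OF f']
    by (intro differentiable_cong_open[OF f''[OF x] U x]) simp
qed

lemma twice_diff_on_cong_open:
  assumes f: "twice_diff_on U f" and U: "open U" and eq: "\<And>x. x \<in> U \<Longrightarrow> f x = g x"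
  shows "twice_diff_on U g"
  using twice_diff_onD[OF f] has_derivative_transform_within_open[OF _ U _ eq]
  by (intro twice_diff_onI[OF U, where f' = "\<lambda>x. frechet_derivative f (at x)"]) auto

lemma twice_diff_on_slice:
  fixes f :: "'a::real_normed_vector \<times> 'b::real_normed_vector \<Rightarrow> 'c::real_normed_vector"
  assumes f: "twice_diff_on U f" and U: "open U"
  shows "twice_diff_on {a. (p, a) \<in> U} (\<lambda>a. f (p, a))"
proof (rule twice_diff_onI)
  have pair: "((\<lambda>a. (p, a)) has_derivative (\<lambda>h. (0, h))) (at a)" for a :: 'b
    by (auto intro!: derivative_eq_intros)
  have "{a. (p, a) \<in> U} = (\<lambda>a. (p, a)) -` U" by auto
  then show "open {a. (p, a) \<in> U}"
    using U by (auto intro!: open_vimage continuous_intros)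
  fix a assume a: "a \<in> {a. (p, a) \<in> U}"
  show "((\<lambda>a. f (p, a)) has_derivative (\<lambda>h. frechet_derivative f (at (p, a)) (0, h))) (at a)"
    using diff_chain_at[OF pair twice_diff_onD(2)[OF f]] a by (simp add: o_def)
  show "(\<lambda>b. frechet_derivative f (at (p, b)) (0, v)) differentiable (at a)" for v
    using differentiable_chain_at[of "\<lambda>b. (p, b)" a "\<lambda>y. frechet_derivative f (at y) (0, v)"]
      twice_diff_onD(3)[OF f, of "(p, a)" "(0, v)"] a differentiableI[OF pair]
    by (simp add: o_def)
qed

lemma pairwise_orthogonal_expand:
  fixes C :: "'a::real_inner set"
  assumes C: "finite C" "pairwise orthogonal C" and "w \<in> span C"
  shows "w = (\<Sum>b\<in>C. (w \<bullet> b / (b \<bullet> b)) *\<^sub>R b)"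
  using assms(3)
proof (induction rule: span_induct_alt)
  case base
  then show ?case by simp
next
  case (step c x y)
  have "(\<Sum>b\<in>C. (x \<bullet> b / (b \<bullet> b)) *\<^sub>R b) = (\<Sum>b\<in>C. if b = x then b else 0)"
    using C(2) step(1) by (intro sum.cong) (auto simp: pairwise_def orthogonal_def)
  also have "\<dots> = x" using C(1) step(1) by simp
  finally have "(\<Sum>b\<in>C. (c *\<^sub>R x \<bullet> b / (b \<bullet> b)) *\<^sub>R b) = c *\<^sub>R x"
    by (metis (no_types, lifting) inner_scaleR_left scaleR_scaleR scaleR_sum_right sum.cong times_divide_eq_right)
  moreover have "(\<Sum>b\<in>C. ((c *\<^sub>R x + y) \<bullet> b / (b \<bullet> b)) *\<^sub>R b) =
      (\<Sum>b\<in>C. (c *\<^sub>R x \<bullet> b / (b \<bullet> b)) *\<^sub>R b) + (\<Sum>b\<in>C. (y \<bullet> b / (b \<bullet> b)) *\<^sub>R b)"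
    by (simp add: inner_add_left add_divide_distrib scaleR_add_left sum.distrib)
  ultimately show ?case using step(2) by simp
qed

text \<open>In \<open>D(P \<circ> \<Phi>)(x) v = DP(\<Phi> x) (D\<Phi>(x) v)\<close> both the point and the direction of the derivative of
  \<open>P\<close> vary with \<open>x\<close>, while second differentiability of \<open>P\<close> only speaks of fixed directions. Expanding
  the moving direction in an orthogonal basis turns the expression into a finite sum of products of
  differentiable functions.\<close>

lemma twice_diff_on_compose:
  fixes \<Phi> :: "'a::real_normed_vector \<Rightarrow> 'b::real_inner" and P :: "'b \<Rightarrow> 'c::real_normed_vector"
  assumes fin: "finite B" "span B = (UNIV :: 'b set)"
    and \<Phi>: "twice_diff_on U \<Phi>" and P: "twice_diff_on V P"
    and U: "open U" and sub: "\<Phi> ` U \<subseteq> V"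
  shows "twice_diff_on U (P \<circ> \<Phi>)"
proof (rule twice_diff_onI[OF U])
  fix x assume x: "x \<in> U"
  then have \<Phi>x: "\<Phi> x \<in> V" using sub by auto
  show "(P \<circ> \<Phi> has_derivative
      (\<lambda>v. frechet_derivative P (at (\<Phi> x)) (frechet_derivative \<Phi> (at x) v))) (at x)"
    using diff_chain_at[OF twice_diff_onD(2)[OF \<Phi> x] twice_diff_onD(2)[OF P \<Phi>x]]
    by (simp add: o_def)
  fix v
  obtain C :: "'b set" where C: "finite C" "pairwise orthogonal C" "span C = UNIV"
    using basis_orthogonal[OF fin(1)] fin(2) by metis
  let ?w = "\<lambda>y. frechet_derivative \<Phi> (at y) v"
  have "(\<lambda>y. frechet_derivative P (at (\<Phi> y)) b) differentiable (at x)" for b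
    using differentiable_chain_at[OF twice_diff_onD(1)[OF \<Phi> x] twice_diff_onD(3)[OF P \<Phi>x]]
    by (simp add: o_def)
  moreover have "(\<lambda>y. ?w y \<bullet> b / (b \<bullet> b)) differentiable (at x)" for b
    unfolding divide_inverse
    by (intro differentiable_mult differentiable_inner twice_diff_onD(3)[OF \<Phi> x]
        differentiable_const)
  ultimately have
    "(\<lambda>y. \<Sum>b\<in>C. (?w y \<bullet> b / (b \<bullet> b)) *\<^sub>R frechet_derivative P (at (\<Phi> y)) b) differentiable (at x)"
    by (intro differentiable_sum ballI differentiable_scaleR C(1))
  moreover have "(\<Sum>b\<in>C. (?w y \<bullet> b / (b \<bullet> b)) *\<^sub>R frechet_derivative P (at (\<Phi> y)) b) =
      frechet_derivative P (at (\<Phi> y)) (?w y)" if "y \<in> U" for y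
  proof -
    have lin: "linear (frechet_derivative P (at (\<Phi> y)))"
      using that sub by (intro linear_frechet_derivative twice_diff_onD(1)[OF P]) auto
    have "?w y = (\<Sum>b\<in>C. (?w y \<bullet> b / (b \<bullet> b)) *\<^sub>R b)"
      using C by (intro pairwise_orthogonal_expand) auto
    then have "frechet_derivative P (at (\<Phi> y)) (?w y) =
        frechet_derivative P (at (\<Phi> y)) (\<Sum>b\<in>C. (?w y \<bullet> b / (b \<bullet> b)) *\<^sub>R b)"
      by (rule arg_cong)
    then show ?thesis
      by (simp add: linear_sum[OF lin] linear_scale[OF lin])
  qed
  ultimately show "(\<lambda>y. frechet_derivative P (at (\<Phi> y)) (?w y)) differentiable (at x)"
    by (rule differentiable_cong_open[OF _ U x])
qed

text \<open>The second-order coefficient is the nested derivative that defines \<open>tangent_hessian\<close>; the two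
  signs from differentiating \<open>t \<mapsto> -t v\<close> twice cancel in it.\<close>

lemma taylor_second_order_on_line:
  fixes F :: "'a::real_normed_vector \<Rightarrow> real"
  assumes F: "twice_diff_on UNIV F" and s: "0 < s"
  obtains \<theta> where "0 < \<theta>" "\<theta> < s"
    "F (- s *\<^sub>R v) = F 0 - s * frechet_derivative F (at 0) v +
       s\<^sup>2 / 2 * frechet_derivative (\<lambda>a. frechet_derivative F (at a) v) (at (- \<theta> *\<^sub>R v)) v"
proof -
  let ?D = "\<lambda>a. frechet_derivative F (at a) v"
  have line: "((\<lambda>t. - t *\<^sub>R v) has_derivative (\<lambda>h. - h *\<^sub>R v)) (at t)" for t :: real
    by (auto intro!: derivative_eq_intros)
  have along: "DERIV (\<lambda>t. f (- t *\<^sub>R v)) t :> - frechet_derivative f (at (- t *\<^sub>R v)) v"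
    if f: "f differentiable (at (- t *\<^sub>R v))" for f :: "'a \<Rightarrow> real" and t
  proof -
    have "((\<lambda>t. f (- t *\<^sub>R v)) has_derivative
        (\<lambda>h. frechet_derivative f (at (- t *\<^sub>R v)) (- h *\<^sub>R v))) (at t)"
      using diff_chain_at[OF line, of f] f by (simp add: frechet_derivative_works o_def)
    moreover have "frechet_derivative f (at (- t *\<^sub>R v)) (- h *\<^sub>R v) =
        - frechet_derivative f (at (- t *\<^sub>R v)) v * h" for h
      using linear_scale[OF linear_frechet_derivative[OF f], of "- h" v] by (simp add: mult.commute)
    ultimately have "((\<lambda>t. f (- t *\<^sub>R v)) has_derivative
        (\<lambda>h. - frechet_derivative f (at (- t *\<^sub>R v)) v * h)) (at t)"
      by (simp only:)
    then show ?thesis unfolding has_field_derivative_def .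
  qed
  define diff where "diff m t = (if m = 0 then F (- t *\<^sub>R v) else if m = 1 then - ?D (- t *\<^sub>R v)
      else frechet_derivative ?D (at (- t *\<^sub>R v)) v)" for m :: nat and t
  have "DERIV (diff m) t :> diff (Suc m) t" if "m < 2" for m t
  proof -
    have "m = 0 \<or> m = 1" using that by auto
    then show ?thesis
    proof
      assume "m = 0"
      then show ?thesis using along[OF twice_diff_onD(1)[OF F]] by (simp add: diff_def[abs_def])
    next
      assume "m = 1"
      then show ?thesis using DERIV_minus[OF along[OF twice_diff_onD(3)[OF F]]]
        by (simp add: diff_def[abs_def])
    qed
  qed
  then obtain \<theta> where "0 < \<theta>" "\<theta> < s"
    and "diff 0 s = (\<Sum>m<2. (diff m 0 / fact m) * s ^ m) + (diff 2 \<theta> / fact 2) * s ^ 2"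
    using Maclaurin[OF s, of 2 diff "diff 0"] by auto
  then show thesis
    by (intro that[of \<theta>]) (simp_all add: diff_def numeral_2_eq_2 algebra_simps)
qed


section \<open>Representing functionals by a positive definite form\<close>

text \<open>The Riesz representation, needed to see that the gradient exists. The form \<open>G\<close> is the metric
  tensor at one point, unrelated to the inner product of the type, so the representing vector is
  built by a Gram-Schmidt recursion over a finite spanning set: a representative \<open>u\<close> on \<open>span B\<close> is
  corrected by a multiple of the part of the new vector that is \<open>G\<close>-orthogonal to \<open>span B\<close>.\<close>

lemma posdef_form_represents_functional:
  fixes G :: "'v::real_vector \<Rightarrow> 'v \<Rightarrow> real" and L :: "'v \<Rightarrow> real"
  assumes fin: "finite B"
    and sym: "\<And>x y. G x y = G y x"
    and lin: "\<And>y. linear (\<lambda>x. G x y)"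
    and pos: "\<And>x. x \<noteq> 0 \<Longrightarrow> G x x > 0"
    and L: "linear L"
  shows "\<exists>u\<in>span B. \<forall>w\<in>span B. G u w = L w"
  using fin L
proof (induction B arbitrary: L rule: finite_induct)
  case empty
  have "G 0 0 = 0" using linear_0[OF lin] .
  then show ?case using empty by (simp add: linear_0)
next
  case (insert b B)
  have lin2: "linear (G y)" for y
    using lin[of y] sym by (metis (no_types, lifting) ext)
  obtain u where u: "u \<in> span B" "\<And>w. w \<in> span B \<Longrightarrow> G u w = L w"
    using insert.IH[OF insert.prems] by blast
  \<comment> \<open>The induction hypothesis also supplies the \<open>G\<close>-orthogonal projection of \<open>b\<close> to \<open>span B\<close>: it is
    the vector that represents \<open>G b\<close> there.\<close>
  obtain p where p: "p \<in> span B" "\<And>w. w \<in> span B \<Longrightarrow> G p w = G b w"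
    using insert.IH[OF lin2[of b]] by blast
  define q where "q = b - p"
  have q_orth: "G q w = 0" if "w \<in> span B" for w
    using p(2)[OF that] by (simp add: q_def linear_diff[OF lin])
  define k' where "k' = (if q = 0 then 0 else L q / G q q)"
  have k': "k' * G q q = L q"
    using pos[of q] insert.prems by (auto simp: k'_def linear_0)
  define u' where "u' = u + k' *\<^sub>R q"
  have Bsub: "span B \<subseteq> span (insert b B)" by (simp add: span_mono subset_insertI)
  have q_in: "q \<in> span (insert b B)"
    using p(1) Bsub unfolding q_def by (blast intro: span_diff span_base)
  have "u' \<in> span (insert b B)"
    unfolding u'_def using u(1) Bsub q_in by (blast intro: span_add span_scale)
  moreover have "G u' w = L w" if w: "w \<in> span (insert b B)" for w
  proof -
    from w obtain k where k: "w - k *\<^sub>R b \<in> span B" by (auto simp: span_breakdown_eq)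
    define z where "z = w - k *\<^sub>R q"
    have "z = (w - k *\<^sub>R b) + k *\<^sub>R p" by (simp add: z_def q_def algebra_simps)
    with k p(1) have z: "z \<in> span B" by (simp add: span_add span_scale)
    have w_eq: "w = z + k *\<^sub>R q" by (simp add: z_def)
    have Guq: "G u q = 0" using q_orth[OF u(1)] sym by simp
    have "G u' w = G u w + k' * G q w"
      by (simp add: u'_def linear_add[OF lin] linear_scale[OF lin])
    also have "G u w = L z"
      using u(2)[OF z] Guq by (simp add: w_eq linear_add[OF lin2] linear_scale[OF lin2])
    also have "G q w = k * G q q"
      using q_orth[OF z] by (simp add: w_eq linear_add[OF lin2] linear_scale[OF lin2])
    also have "L z + k' * (k * G q q) = L z + k * L q"
      using k' by (simp add: mult.left_commute)
    also have "\<dots> = L w"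
      using insert.prems by (simp add: w_eq linear_add linear_scale)
    finally show ?thesis .
  qed
  ultimately show ?case by blast
qed


section \<open>Tangent spaces\<close>

context smooth_manifold
begin

lemma cinv_cmap: "c \<in> A \<Longrightarrow> x \<in> cdom c \<Longrightarrow> cinv c (cmap c x) = x"
  by (simp add: cinv_def chart_inj)

lemma transition_differentiable:
  assumes "c \<in> charts_at A x" "d \<in> charts_at A x"
  shows "(cmap d \<circ> cinv c) differentiable (at (cmap c x))"
  using chart_smooth[of c d 1] assms by (auto simp: charts_at_def)

lemma transition_derivative_self:
  assumes c: "c \<in> charts_at A x"
  shows "frechet_derivative (cmap c \<circ> cinv c) (at (cmap c x)) = id"
proof -
  from c have cA: "c \<in> A" "x \<in> cdom c" by (auto simp: charts_at_def)
  have "frechet_derivative (cmap c \<circ> cinv c) (at (cmap c x)) = frechet_derivative id (at (cmap c x))"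
    using chart_open[OF cA(1) cA(1)] cA cinv_cmap[OF cA(1)]
    by (intro frechet_derivative_transform_within_open[OF transition_differentiable[OF c c],
          of "cmap c ` cdom c"]) auto
  then show ?thesis by simp
qed

text \<open>The chain rule for transition maps. It is what makes the components prescribed in one chart
  extend consistently to a tangent vector.\<close>

lemma transition_derivative_cocycle:
  assumes c: "c \<in> charts_at A x" and d: "d \<in> charts_at A x" and e: "e \<in> charts_at A x"
  shows "frechet_derivative (cmap e \<circ> cinv c) (at (cmap c x)) a =
    frechet_derivative (cmap e \<circ> cinv d) (at (cmap d x))
      (frechet_derivative (cmap d \<circ> cinv c) (at (cmap c x)) a)"
proof -
  from c d e have A: "c \<in> A" "d \<in> A" "e \<in> A" and x: "x \<in> cdom c" "x \<in> cdom d" "x \<in> cdom e"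
    by (auto simp: charts_at_def)
  have d_eq: "(cmap d \<circ> cinv c) (cmap c x) = cmap d x"
    using cinv_cmap[OF A(1) x(1)] by simp
  have "frechet_derivative (cmap e \<circ> cinv c) (at (cmap c x)) =
      frechet_derivative ((cmap e \<circ> cinv d) \<circ> (cmap d \<circ> cinv c)) (at (cmap c x))"
  proof (rule frechet_derivative_transform_within_open[OF transition_differentiable[OF c e]])
    show "open (cmap c ` (cdom c \<inter> cdom d))" using chart_open A by blast
    show "cmap c x \<in> cmap c ` (cdom c \<inter> cdom d)" using x by blast
  qed (auto simp: cinv_cmap A)
  also have "\<dots> = frechet_derivative (cmap e \<circ> cinv d) (at (cmap d x)) \<circ>
      frechet_derivative (cmap d \<circ> cinv c) (at (cmap c x))"
    using frechet_derivative_compose[OF transition_differentiable[OF c d], of "cmap e \<circ> cinv d"]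
      transition_differentiable[OF d e] d_eq by simp
  finally show ?thesis by simp
qed

lemma tvec_of_component:
  "c \<in> charts_at A x \<Longrightarrow> tvec_of A c x a c = a"
  by (simp add: tvec_of_def transition_derivative_self)

lemma tvec_of_in_tangent_space:
  "c \<in> charts_at A x \<Longrightarrow> tvec_of A c x a \<in> tangent_space A x"
  unfolding tangent_space_def tvec_of_def
  by (simp add: transition_derivative_cocycle[symmetric])

lemma tvec_of_tangent_vector:
  assumes c: "c \<in> charts_at A x" and v: "v \<in> tangent_space A x"
  shows "tvec_of A c x (v c) = v"
proof
  fix d
  have "d \<in> charts_at A x \<Longrightarrow> v d = frechet_derivative (cmap d \<circ> cinv c) (at (cmap c x)) (v c)"
    and "d \<notin> charts_at A x \<Longrightarrow> v d = 0"
    using c v unfolding tangent_space_def by blast+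
  then show "tvec_of A c x (v c) d = v d"
    unfolding tvec_of_def by presburger
qed

lemma linear_tvec_of:
  assumes c: "c \<in> charts_at A x"
  shows "linear (tvec_of A c x)"
proof -
  have lin: "linear (frechet_derivative (cmap d \<circ> cinv c) (at (cmap c x)))" if "d \<in> charts_at A x" for d
    using transition_differentiable[OF c that] by (rule linear_frechet_derivative)
  show ?thesis
    using linear_add[OF lin] linear_scale[OF lin]
    by (intro linearI) (auto simp: tvec_of_def fun_eq_iff plus_fun_def scaleR_fun_def)
qed

lemma tangent_space_eq_range: "c \<in> charts_at A x \<Longrightarrow> tangent_space A x = range (tvec_of A c x)"
  by (blast intro: tvec_of_in_tangent_space tvec_of_tangent_vector[symmetric])

lemma some_chart_at: "x \<in> points A \<Longrightarrow> (SOME c. c \<in> charts_at A x) \<in> charts_at A x"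
  by (rule someI_ex) (auto simp: points_def charts_at_def)

lemma subspace_tangent_space:
  assumes "x \<in> points A" shows "subspace (tangent_space A x)"
  using tangent_space_eq_range[OF some_chart_at[OF assms]]
    linear_subspace_image[OF linear_tvec_of[OF some_chart_at[OF assms]] subspace_UNIV] by simp

lemma hull_at_subset_tangent_space:
  assumes "vector_field_family A \<Omega> H" "x \<in> points A"
  shows "hull_at \<Omega> H x \<subseteq> tangent_space A x"
  unfolding hull_at_def using assms
  by (intro hull_minimal subspace_imp_convex subspace_tangent_space)
     (auto simp: vector_field_family_def)

text \<open>A tangent chart restricted to the fibre over \<open>x\<close> is the identification of \<open>tangent_space A x\<close> with
  the model space, so smoothness on the tangent bundle can be read off on a single fibre.\<close>

lemma tangent_chart_inv:
  assumes c: "c \<in> charts_at A x"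
  shows "cinv (Sigma (cdom c) (tangent_space A), \<lambda>(x, v). (cmap c x, v c)) (cmap c x, a) =
    (x, tvec_of A c x a)"
proof -
  have inj: "inj_on (\<lambda>(x, v). (cmap c x, v c)) (Sigma (cdom c) (tangent_space A))"
  proof (rule inj_onI, clarsimp)
    fix y v z w
    assume yz: "y \<in> cdom c" "z \<in> cdom c" "cmap c y = cmap c z"
      and vw: "v \<in> tangent_space A y" "w \<in> tangent_space A z" "v c = w c"
    have "y = z" using yz c chart_inj[of c] by (auto simp: charts_at_def dest: inj_onD)
    moreover from this have "c \<in> charts_at A z" "v \<in> tangent_space A z"
      using vw yz c by (auto simp: charts_at_def)
    then have "v = w"
      using tvec_of_tangent_vector[of c z v] tvec_of_tangent_vector[of c z w] vw(2,3) by metis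
    ultimately show "y = z \<and> v = w" by simp
  qed
  have "(x, tvec_of A c x a) \<in> Sigma (cdom c) (tangent_space A)"
    using c tvec_of_in_tangent_space by (auto simp: charts_at_def)
  from inv_into_f_f[OF inj this] show ?thesis
    using c by (simp add: cinv_def tvec_of_component)
qed


section \<open>The function along the retraction\<close>

text \<open>The coordinate representation of \<open>R\<close> on the tangent bundle is \<open>C\<^sup>2\<close> on an open set \<open>U\<close> of pairs of
  a base point and a vector; \<open>S\<close> is the slice of \<open>U\<close> over the base point \<open>x\<close>.\<close>

lemma retraction_on_fibre:
  assumes R: "manifold_retraction A R" and c: "c \<in> charts_at A x" and d: "d \<in> A"
  defines "S \<equiv> {a. R x (tvec_of A c x a) \<in> cdom d}"
  shows "open S" and "twice_diff_on S (\<lambda>a. cmap d (R x (tvec_of A c x a)))"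
proof -
  define T :: "('m \<times> ('m, 'e) tvec, 'e \<times> 'e) chart"
    where "T = (Sigma (cdom c) (tangent_space A), \<lambda>(x, v). (cmap c x, v c))"
  define U where "U = cmap T ` (cdom T \<inter> (\<lambda>(x, v). R x v) -` cdom d)"
  have "T \<in> tangent_atlas A"
    using c by (auto simp: T_def tangent_atlas_def charts_at_def)
  then have U: "open U" "Ck_on 2 U (cmap d \<circ> (\<lambda>(x, v). R x v) \<circ> cinv T)"
    using R d by (auto simp: manifold_retraction_def Ck_map_def U_def)
  have fibre: "(cmap c x, a) \<in> U \<longleftrightarrow> R x (tvec_of A c x a) \<in> cdom d" for a
  proof
    assume "(cmap c x, a) \<in> U"
    then obtain y v where yv: "y \<in> cdom c" "v \<in> tangent_space A y" "R y v \<in> cdom d"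
      "cmap c x = cmap c y" "a = v c"
      by (auto simp: U_def T_def)
    moreover have "y = x" using yv c chart_inj[of c] by (auto simp: charts_at_def dest: inj_onD)
    ultimately show "R x (tvec_of A c x a) \<in> cdom d"
      using tvec_of_tangent_vector[OF c] by simp
  next
    assume "R x (tvec_of A c x a) \<in> cdom d"
    then show "(cmap c x, a) \<in> U"
      using c tvec_of_in_tangent_space[OF c] tvec_of_component[OF c]
      unfolding U_def T_def by (intro image_eqI[of _ _ "(x, tvec_of A c x a)"]) (auto simp: charts_at_def)
  qed
  then have S: "S = {a. (cmap c x, a) \<in> U}" by (auto simp: S_def)
  have "{a. (cmap c x, a) \<in> U} = (\<lambda>a. (cmap c x, a)) -` U" by auto
  then show "open S" unfolding S using U(1) by (auto intro!: open_vimage continuous_intros)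
  show "twice_diff_on S (\<lambda>a. cmap d (R x (tvec_of A c x a)))"
    using twice_diff_on_slice[OF Ck_on_2_imp_twice_diff_on[OF U(2)] U(1), of "cmap c x"]
      tangent_chart_inv[OF c]
    by (simp add: S T_def)
qed

lemma retraction_in_points:
  assumes "manifold_retraction A R" "x \<in> points A" "v \<in> tangent_space A x"
  shows "R x v \<in> points A"
proof -
  have "(x, v) \<in> points (tangent_atlas A)"
    using assms(2,3) by (auto simp: points_def tangent_atlas_def)
  then show ?thesis
    using assms(1) by (force simp: manifold_retraction_def Ck_map_def)
qed

lemma C2_function_in_chart:
  assumes "Ck_map 2 A standard_atlas \<rho>" "c \<in> A"
  shows "twice_diff_on (cmap c ` cdom c) (\<rho> \<circ> cinv c)"
  using assms Ck_on_2_imp_twice_diff_on[of "cmap c ` cdom c" "\<rho> \<circ> cinv c"]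
  by (auto simp: Ck_map_def standard_atlas_def)

text \<open>The image of a fibre under \<open>R\<^sub>x\<close> need not lie in one chart domain; near each vector \<open>a\<close> the function
  is factored through a chart around \<open>R\<^sub>x(a)\<close>.\<close>

lemma twice_diff_on_retraction_pullback:
  assumes R: "manifold_retraction A R" and \<rho>: "Ck_map 2 A standard_atlas \<rho>"
    and c: "c \<in> charts_at A x"
  shows "twice_diff_on UNIV ((\<rho> \<circ> R x) \<circ> tvec_of A c x)"
proof -
  have "\<exists>U. a \<in> U \<and> twice_diff_on U ((\<rho> \<circ> R x) \<circ> tvec_of A c x)" for a
  proof -
    have x: "x \<in> points A" using c by (auto simp: points_def charts_at_def)
    obtain d where d: "d \<in> A" "R x (tvec_of A c x a) \<in> cdom d"
      using retraction_in_points[OF R x tvec_of_in_tangent_space[OF c], of a]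
      unfolding points_def by blast
    define S where "S = {a. R x (tvec_of A c x a) \<in> cdom d}"
    note S = retraction_on_fibre[OF R c d(1), folded S_def]
    obtain B :: "'e set" where B: "finite B" "span B = UNIV" using finite_dim by blast
    have "twice_diff_on S ((\<rho> \<circ> cinv d) \<circ> (\<lambda>a. cmap d (R x (tvec_of A c x a))))"
      by (rule twice_diff_on_compose[OF B S(2) C2_function_in_chart[OF \<rho> d(1)] S(1)])
         (auto simp: S_def)
    then have "twice_diff_on S ((\<rho> \<circ> R x) \<circ> tvec_of A c x)"
      by (rule twice_diff_on_cong_open[OF _ S(1)]) (auto simp: S_def cinv_cmap[OF d(1)])
    then show ?thesis using d(2) by (auto simp: S_def)
  qed
  then show ?thesis unfolding twice_diff_on_def by blast
qed

lemma retraction_pullback_derivative_at_0: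
  assumes R: "manifold_retraction A R" and \<rho>: "Ck_map 2 A standard_atlas \<rho>"
    and c: "c \<in> charts_at A x"
  shows "frechet_derivative ((\<rho> \<circ> R x) \<circ> tvec_of A c x) (at 0) =
    frechet_derivative (\<rho> \<circ> cinv c) (at (cmap c x))"
proof -
  from c have cA: "c \<in> A" "x \<in> cdom c" and x: "x \<in> points A"
    by (auto simp: points_def charts_at_def)
  have R0: "R x (tvec_of A c x 0) = x"
    using R x linear_0[OF linear_tvec_of[OF c]] by (simp add: manifold_retraction_def)
  have "((\<lambda>a. cmap c (R x (tvec_of A c x a))) has_derivative (\<lambda>a. a)) (at 0)"
    using R x c by (auto simp: manifold_retraction_def)
  moreover have "(\<rho> \<circ> cinv c has_derivative frechet_derivative (\<rho> \<circ> cinv c) (at (cmap c x)))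
      (at (cmap c (R x (tvec_of A c x 0))))"
    unfolding R0 using cA by (intro twice_diff_onD(2)[OF C2_function_in_chart[OF \<rho>]]) auto
  ultimately have "((\<rho> \<circ> cinv c) \<circ> (\<lambda>a. cmap c (R x (tvec_of A c x a))) has_derivative
      frechet_derivative (\<rho> \<circ> cinv c) (at (cmap c x)) \<circ> (\<lambda>a. a)) (at 0)"
    by (rule diff_chain_at)
  then have "((\<rho> \<circ> R x) \<circ> tvec_of A c x has_derivative
      frechet_derivative (\<rho> \<circ> cinv c) (at (cmap c x)) \<circ> (\<lambda>a. a)) (at 0)"
    by (rule has_derivative_transform_within_open[OF _ retraction_on_fibre(1)[OF R c cA(1)]])
       (auto simp: R0 cA cinv_cmap)
  from frechet_derivative_at[OF this] show ?thesis by (simp add: o_def)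
qed

text \<open>Taylor's formula in the chart that \<open>differential\<close> and \<open>tangent_hessian\<close> select: there the
  derivatives of the coordinate expression are these two notions literally.\<close>

lemma retraction_step_taylor:
  assumes R: "manifold_retraction A R" and \<rho>: "Ck_map 2 A standard_atlas \<rho>"
    and x: "x \<in> points A" and v: "v \<in> tangent_space A x" and s: "0 < s"
  obtains \<theta> where "0 < \<theta>" "\<theta> < s"
    "\<rho> (R x (- s *\<^sub>R v)) = \<rho> x - s * differential A \<rho> x v +
       s\<^sup>2 / 2 * tangent_hessian A x (\<rho> \<circ> R x) (- \<theta> *\<^sub>R v) v v"
proof -
  define c where "c = (SOME c. c \<in> charts_at A x)"
  have c: "c \<in> charts_at A x" using some_chart_at[OF x] by (simp add: c_def)
  let ?F = "(\<rho> \<circ> R x) \<circ> tvec_of A c x"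
  obtain \<theta> where \<theta>: "0 < \<theta>" "\<theta> < s" and
    eq: "?F (- s *\<^sub>R v c) = ?F 0 - s * frechet_derivative ?F (at 0) (v c) + s\<^sup>2 / 2 *
      frechet_derivative (\<lambda>a. frechet_derivative ?F (at a) (v c)) (at (- \<theta> *\<^sub>R v c)) (v c)"
    using taylor_second_order_on_line[OF twice_diff_on_retraction_pullback[OF R \<rho> c] s] by blast
  have "tvec_of A c x (- s *\<^sub>R v c) = - s *\<^sub>R v"
    using linear_scale[OF linear_tvec_of[OF c], of "- s" "v c"] tvec_of_tangent_vector[OF c v] by simp
  moreover have "?F 0 = \<rho> x"
    using R x linear_0[OF linear_tvec_of[OF c]] by (simp add: manifold_retraction_def)
  moreover have "frechet_derivative ?F (at 0) (v c) = differential A \<rho> x v"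
    using retraction_pullback_derivative_at_0[OF R \<rho> c]
    by (simp add: differential_def Let_def c_def[symmetric])
  moreover have "frechet_derivative (\<lambda>a. frechet_derivative ?F (at a) (v c)) (at (- \<theta> *\<^sub>R v c)) (v c) =
      tangent_hessian A x (\<rho> \<circ> R x) (- \<theta> *\<^sub>R v) v v"
    by (simp add: tangent_hessian_def Let_def c_def[symmetric] scaleR_fun_def)
  ultimately show thesis using that[OF \<theta>] eq by simp
qed

lemma linear_differential:
  assumes \<rho>: "Ck_map 2 A standard_atlas \<rho>" and x: "x \<in> points A"
  shows "linear (differential A \<rho> x)"
proof -
  define c where "c = (SOME c. c \<in> charts_at A x)"
  have "c \<in> A" "x \<in> cdom c" using some_chart_at[OF x] by (auto simp: c_def charts_at_def)
  then have lin: "linear (frechet_derivative (\<rho> \<circ> cinv c) (at (cmap c x)))"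
    by (intro linear_frechet_derivative twice_diff_onD(1)[OF C2_function_in_chart[OF \<rho>]]) auto
  have "differential A \<rho> x = (\<lambda>v. frechet_derivative (\<rho> \<circ> cinv c) (at (cmap c x)) (v c))"
    by (simp add: differential_def Let_def c_def fun_eq_iff)
  then show ?thesis
    using linear_add[OF lin] linear_scale[OF lin]
    by (intro linearI) (simp_all add: plus_fun_def scaleR_fun_def)
qed

end


section \<open>The Riemannian gradient\<close>

context riemannian_manifold
begin

text \<open>The content is that the definite description of the gradient is satisfied by exactly one vector:
  existence is the Riesz representation, transported to the model space by a chart, and uniqueness
  is definiteness of the metric.\<close>

lemma gradient_inner_eq_differential:
  assumes \<rho>: "Ck_map 2 A standard_atlas \<rho>" and x: "x \<in> points A" and v: "v \<in> tangent_space A x"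
  shows "g x (gradient A g \<rho> x) v = differential A \<rho> x v"
proof -
  obtain c where c: "c \<in> charts_at A x" using some_chart_at[OF x] by blast
  let ?T = "tvec_of A c x"
  note lin = linear_tvec_of[OF c]
  note mem = tvec_of_in_tangent_space[OF c]
  define G where "G a b = g x (?T a) (?T b)" for a b
  obtain B :: "'e set" where B: "finite B" "span B = UNIV" using finite_dim by blast
  have "linear (\<lambda>a. G a b)" for b
    using metric_add[OF x mem mem mem] metric_scale[OF x mem mem]
    by (intro linearI) (simp_all add: G_def linear_add[OF lin] linear_scale[OF lin])
  moreover have "G a a > 0" if "a \<noteq> 0" for a
  proof -
    have "?T a \<noteq> 0" using that tvec_of_component[OF c, of a] by auto
    then show ?thesis using metric_pos[OF x mem] by (simp add: G_def)
  qed
  moreover have "linear (differential A \<rho> x \<circ> ?T)"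
    by (rule linear_compose[OF lin linear_differential[OF \<rho> x]])
  ultimately obtain u0 where u0: "\<And>w. G u0 w = differential A \<rho> x (?T w)"
    using posdef_form_represents_functional[OF B(1), of G "differential A \<rho> x \<circ> ?T"]
      metric_sym[OF x mem mem] B(2) by (auto simp: G_def)
  have "gradient A g \<rho> x = ?T u0"
    unfolding gradient_def
  proof (rule the_equality, intro conjI ballI)
    show "?T u0 \<in> tangent_space A x" by (rule mem)
    show "g x (?T u0) w = differential A \<rho> x w" if "w \<in> tangent_space A x" for w
      using u0[of "w c"] tvec_of_tangent_vector[OF c that] by (simp add: G_def)
  next
    fix u assume u: "u \<in> tangent_space A x \<and> (\<forall>v\<in>tangent_space A x. g x u v = differential A \<rho> x v)"
    define z where "z = u - ?T u0"
    have z: "z \<in> tangent_space A x" and mz: "(-1) *\<^sub>R ?T u0 \<in> tangent_space A x"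
      using u mem subspace_tangent_space[OF x] unfolding z_def
      by (blast intro: subspace_diff subspace_scale)+
    have "z = u + (-1) *\<^sub>R ?T u0" by (simp add: z_def)
    then have "g x z z = g x u z + (-1) * g x (?T u0) z"
      using metric_add[OF x _ mz z, of u] metric_scale[OF x mem z, of "-1" u0] u by metis
    also have "\<dots> = 0"
      using u z u0[of "z c"] tvec_of_tangent_vector[OF c z] by (simp add: G_def)
    finally have "z = 0" using metric_pos[OF x z] by fastforce
    then show "u = ?T u0" by (simp add: z_def)
  qed
  then show ?thesis
    using u0[of "v c"] tvec_of_tangent_vector[OF c v] by (simp add: G_def)
qed

text \<open>The confinement condition is only imposed on the vectors \<open>H(x, \<omega>)\<close>, but it cuts out a half-space,
  which is convex.\<close>

lemma confinement_level_on_hull: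
  assumes \<rho>: "Ck_map 2 A standard_atlas \<rho>" and H: "vector_field_family A \<Omega> H"
    and level: "confinement_level A g \<Omega> H \<rho> \<rho>0"
    and x: "x \<in> points A" "\<rho> x \<ge> \<rho>0" and v: "v \<in> hull_at \<Omega> H x"
  shows "differential A \<rho> x v \<ge> 0"
proof -
  note lin = linear_differential[OF \<rho> x(1)]
  have "convex {v. differential A \<rho> x v \<ge> 0}"
    by (rule convexI) (simp add: linear_add[OF lin] linear_scale[OF lin])
  moreover have "differential A \<rho> x (H x \<omega>) \<ge> 0" if "\<omega> \<in> \<Omega>" for \<omega>
  proof -
    have "H x \<omega> \<in> tangent_space A x" using H x(1) that by (simp add: vector_field_family_def)
    moreover have "g x (gradient A g \<rho> x) (H x \<omega>) \<ge> 0"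
      using level x that by (simp add: confinement_level_def)
    ultimately show ?thesis by (simp add: gradient_inner_eq_differential[OF \<rho> x(1)])
  qed
  then have "(\<lambda>\<omega>. H x \<omega>) ` \<Omega> \<subseteq> {v. differential A \<rho> x v \<ge> 0}" by auto
  ultimately have "hull_at \<Omega> H x \<subseteq> {v. differential A \<rho> x v \<ge> 0}"
    unfolding hull_at_def by (rule hull_minimal[rotated])
  then show ?thesis using v by auto
qed

lemma Lambda_bound_le_imp:
  assumes \<rho>: "Ck_map 2 A standard_atlas \<rho>" and H: "vector_field_family A \<Omega> H"
    and l: "l > 0" and \<phi>: "Lambda_bound A g \<Omega> H \<rho> \<rho>0 l \<le> ereal \<phi>"
    and x: "x \<in> points A" "\<rho> x \<le> \<rho>0" and v: "v \<in> hull_at \<Omega> H x"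
  shows "- differential A \<rho> x v \<le> l * \<phi>"
proof -
  have "ereal (1 / l) * ereal (max 0 (- g x (gradient A g \<rho> x) v)) \<le> Lambda_bound A g \<Omega> H \<rho> \<rho>0 l"
    unfolding Lambda_bound_def using l x v
    by (intro ereal_mult_left_mono Sup_upper) auto
  from order_trans[OF this \<phi>] have "1 / l * max 0 (- g x (gradient A g \<rho> x) v) \<le> \<phi>"
    by (simp only: times_ereal.simps ereal_less_eq)
  then have "max 0 (- g x (gradient A g \<rho> x) v) \<le> l * \<phi>"
    using l by (simp add: field_simps)
  then show ?thesis
    using gradient_inner_eq_differential[OF \<rho> x(1), of v] hull_at_subset_tangent_space[OF H x(1)] v
    by auto
qed

end

lemma B_bound_le_imp:
  assumes b: "b > 0" and \<phi>: "B_bound A R \<Omega> H \<rho> \<rho>1 \<Theta> b \<le> ereal \<phi>"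
    and x: "x \<in> points A" "\<rho> x \<le> \<rho>1" and v: "v \<in> hull_at \<Omega> H x"
    and \<theta>: "0 \<le> \<theta>" "\<theta> \<le> \<Theta>"
  shows "tangent_hessian A x (\<rho> \<circ> R x) (- \<theta> *\<^sub>R v) v v \<le> (b * \<phi>)\<^sup>2"
proof -
  let ?h = "tangent_hessian A x (\<rho> \<circ> R x) (- \<theta> *\<^sub>R v) v v"
  have "ereal (1 / b) * ereal (sqrt (max 0 ?h)) \<le> B_bound A R \<Omega> H \<rho> \<rho>1 \<Theta> b"
    unfolding B_bound_def using b x v \<theta>
    by (intro ereal_mult_left_mono Sup_upper) (blast, simp)
  from order_trans[OF this \<phi>] have "1 / b * sqrt (max 0 ?h) \<le> \<phi>"
    by (simp only: times_ereal.simps ereal_less_eq)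
  then have "sqrt (max 0 ?h) \<le> b * \<phi>"
    using b by (simp add: field_simps)
  then have "max 0 ?h \<le> (b * \<phi>)\<^sup>2" by (rule sqrt_le_D)
  then show ?thesis by simp
qed


section \<open>Confinement of the iterates\<close>

context riemannian_manifold
begin

text \<open>The maximum distinguishes the two regimes: below \<open>\<rho>\<^sub>0\<close> the first-order term may raise \<open>\<rho>\<close>, but only
  by \<open>l \<gamma>\<close>; above \<open>\<rho>\<^sub>0\<close> it cannot raise \<open>\<rho>\<close>.\<close>

lemma confinement_step:
  assumes R: "manifold_retraction A R" and \<rho>: "Ck_map 2 A standard_atlas \<rho>"
    and H: "vector_field_family A \<Omega> H" and level: "confinement_level A g \<Omega> H \<rho> \<rho>0"
    and pos: "\<gamma> > 0" "l > 0" "b > 0" "\<phi> > 0" and le: "\<gamma> / \<phi> \<le> \<Theta>"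
    and \<Lambda>: "Lambda_bound A g \<Omega> H \<rho> \<rho>0 l \<le> ereal \<phi>"
    and B: "B_bound A R \<Omega> H \<rho> \<rho>1 \<Theta> b \<le> ereal \<phi>"
    and x: "x \<in> points A" "\<rho> x \<le> \<rho>1" and v: "v \<in> hull_at \<Omega> H x"
  shows "\<rho> (R x (- (\<gamma> / \<phi>) *\<^sub>R v)) \<le> max (\<rho>0 + l * \<gamma>) (\<rho> x) + b\<^sup>2 * \<gamma>\<^sup>2 / 2"
proof -
  have s: "\<gamma> / \<phi> > 0" using pos by simp
  have vT: "v \<in> tangent_space A x" using hull_at_subset_tangent_space[OF H x(1)] v by blast
  obtain \<theta> where \<theta>: "0 < \<theta>" "\<theta> < \<gamma> / \<phi>" and
    eq: "\<rho> (R x (- (\<gamma> / \<phi>) *\<^sub>R v)) = \<rho> x - \<gamma> / \<phi> * differential A \<rho> x v +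
       (\<gamma> / \<phi>)\<^sup>2 / 2 * tangent_hessian A x (\<rho> \<circ> R x) (- \<theta> *\<^sub>R v) v v"
    using retraction_step_taylor[OF R \<rho> x(1) vT s] by blast
  have "(\<gamma> / \<phi>)\<^sup>2 / 2 * tangent_hessian A x (\<rho> \<circ> R x) (- \<theta> *\<^sub>R v) v v \<le> (\<gamma> / \<phi>)\<^sup>2 / 2 * (b * \<phi>)\<^sup>2"
    using \<theta> le by (intro mult_left_mono B_bound_le_imp[OF pos(3) B x v]) auto
  also have "\<dots> = b\<^sup>2 * \<gamma>\<^sup>2 / 2"
    using pos(4) by (simp add: power_mult_distrib power_divide)
  finally have second: "(\<gamma> / \<phi>)\<^sup>2 / 2 * tangent_hessian A x (\<rho> \<circ> R x) (- \<theta> *\<^sub>R v) v v \<le> b\<^sup>2 * \<gamma>\<^sup>2 / 2" .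
  have first: "\<rho> x - \<gamma> / \<phi> * differential A \<rho> x v \<le> max (\<rho>0 + l * \<gamma>) (\<rho> x)"
  proof (cases "\<rho> x \<le> \<rho>0")
    case True
    have "\<gamma> / \<phi> * (- differential A \<rho> x v) \<le> \<gamma> / \<phi> * (l * \<phi>)"
      using s by (intro mult_left_mono Lambda_bound_le_imp[OF \<rho> H pos(2) \<Lambda> x(1) True v]) auto
    also have "\<dots> = l * \<gamma>" using pos(4) by simp
    finally show ?thesis using True by simp
  next
    case False
    then have "\<gamma> / \<phi> * differential A \<rho> x v \<ge> 0"
      using s by (intro mult_nonneg_nonneg confinement_level_on_hull[OF \<rho> H level x(1) _ v]) auto
    then show ?thesis by simp
  qed
  show ?thesis using first second eq by linarith
qed

text \<open>By induction \<open>\<rho>(x\<^sub>t)\<close> stays below \<open>\<rho>\<^sub>0 + l c\<close> plus the second-order terms spent so far. This bound never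
  exceeds \<open>\<rho>\<^sub>1\<close>, so the Hessian bound on \<open>{\<rho> \<le> \<rho>\<^sub>1}\<close> remains applicable at the next step.\<close>

lemma confined_iterates:
  assumes R: "manifold_retraction A R" and \<rho>: "Ck_map 2 A standard_atlas \<rho>"
    and H: "vector_field_family A \<Omega> H" and level: "confinement_level A g \<Omega> H \<rho> \<rho>0"
    and \<gamma>: "\<And>t. \<gamma> t > 0" "summable (\<lambda>t. (\<gamma> t)\<^sup>2)" "\<And>t. \<gamma> t \<le> c"
    and pos: "l > 0" "b > 0" "\<Theta> > 0" "\<phi> > 0"
    and \<rho>1: "\<rho>1 = \<rho>0 + l * c + b\<^sup>2 * (\<Sum>t. (\<gamma> t)\<^sup>2) / 2"
    and \<Lambda>: "Lambda_bound A g \<Omega> H \<rho> \<rho>0 l \<le> ereal \<phi>"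
    and B: "B_bound A R \<Omega> H \<rho> \<rho>1 \<Theta> b \<le> ereal \<phi>"
    and c: "c / \<Theta> \<le> \<phi>"
    and x: "\<And>t. x t \<in> points A" and u: "\<And>t. u t \<in> hull_at \<Omega> H (x t)"
    and start: "\<rho> (x 0) \<le> \<rho>0"
    and step: "\<And>t. x (Suc t) = R (x t) (- (\<gamma> t / \<phi>) *\<^sub>R u t)"
  shows "\<rho> (x t) \<le> \<rho>1"
proof -
  have partial: "\<rho>0 + l * c + b\<^sup>2 * (\<Sum>i<t. (\<gamma> i)\<^sup>2) / 2 \<le> \<rho>1" for t
    unfolding \<rho>1 using sum_le_suminf[OF \<gamma>(2), of "{..<t}"]
    by (intro add_left_mono divide_right_mono mult_left_mono) auto
  have "\<rho> (x t) \<le> \<rho>0 + l * c + b\<^sup>2 * (\<Sum>i<t. (\<gamma> i)\<^sup>2) / 2"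
  proof (induction t)
    case 0
    have "0 < l * c" using pos(1) \<gamma>(1,3) less_le_trans by (intro mult_pos_pos) blast+
    then show ?case using start by simp
  next
    case (Suc t)
    have "\<gamma> t / \<phi> \<le> c / \<phi>" using \<gamma>(3) pos(4) by (simp add: divide_right_mono)
    also have "c / \<phi> \<le> \<Theta>" using c pos by (simp add: field_simps)
    finally have "\<rho> (x (Suc t)) \<le> max (\<rho>0 + l * \<gamma> t) (\<rho> (x t)) + b\<^sup>2 * (\<gamma> t)\<^sup>2 / 2"
      unfolding step using Suc.IH partial[of t]
      by (intro confinement_step[OF R \<rho> H level \<gamma>(1) pos(1,2,4) _ \<Lambda> B x _ u]) auto
    also have "max (\<rho>0 + l * \<gamma> t) (\<rho> (x t)) \<le> \<rho>0 + l * c + b\<^sup>2 * (\<Sum>i<t. (\<gamma> i)\<^sup>2) / 2"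
    proof -
      have "l * \<gamma> t \<le> l * c" using \<gamma>(3) pos(1) by simp
      moreover have "0 \<le> b\<^sup>2 * (\<Sum>i<t. (\<gamma> i)\<^sup>2) / 2" by (simp add: sum_nonneg)
      ultimately show ?thesis using Suc.IH by simp
    qed
    finally show ?case by (simp add: algebra_simps add_divide_distrib)
  qed
  then show ?thesis using partial[of t] by linarith
qed

text \<open>In the collar the level condition holds at every parameter in \<open>[0, \<kappa>]\<close>, in particular at the
  intermediate \<open>\<theta>\<close> of Taylor's formula. Its factor \<open>\<kappa>/2\<close> is at least the \<open>\<eta>/2\<close> required, which helps only
  where the Hessian is positive; where it is not, the second-order term does not raise \<open>\<rho>\<close>.\<close>

lemma batch_confined_step:
  assumes R: "manifold_retraction A R" and \<rho>: "Ck_map 2 A standard_atlas \<rho>"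
    and H: "vector_field_family A \<Omega> H" and levels: "batch_levels A g R \<Omega> H \<kappa> \<rho> \<rho>0 \<rho>1"
    and \<eta>: "0 < \<eta>" "\<eta> \<le> \<kappa>"
    and x: "x \<in> points A" "\<rho> x \<le> \<rho>1" and v: "v \<in> hull_at \<Omega> H x"
  shows "\<rho> (R x (- \<eta> *\<^sub>R v)) \<le> \<rho>1"
proof (cases "\<rho> x \<le> \<rho>0")
  case True
  then show ?thesis using levels \<eta> x(1) v by (auto simp: batch_levels_def)
next
  case False
  have vT: "v \<in> tangent_space A x" using hull_at_subset_tangent_space[OF H x(1)] v by blast
  let ?h = "\<lambda>\<theta>. tangent_hessian A x (\<rho> \<circ> R x) (- \<theta> *\<^sub>R v) v v"
  obtain \<theta> where \<theta>: "0 < \<theta>" "\<theta> < \<eta>" and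
    eq: "\<rho> (R x (- \<eta> *\<^sub>R v)) = \<rho> x - \<eta> * differential A \<rho> x v + \<eta>\<^sup>2 / 2 * ?h \<theta>"
    using retraction_step_taylor[OF R \<rho> x(1) vT \<eta>(1)] by blast
  have "g x (gradient A g \<rho> x) v \<ge> max 0 (\<kappa> / 2 * ?h \<theta>)"
    using levels[unfolded batch_levels_def, rule_format, of \<theta> x v] False x v \<theta> \<eta> by simp
  then have d: "0 \<le> differential A \<rho> x v" "\<kappa> / 2 * ?h \<theta> \<le> differential A \<rho> x v"
    using gradient_inner_eq_differential[OF \<rho> x(1) vT] by auto
  have "\<eta> / 2 * ?h \<theta> \<le> differential A \<rho> x v"
  proof (cases "?h \<theta> \<le> 0")
    case True
    then show ?thesis using d(1) \<eta>(1) by (meson half_gt_zero less_imp_le mult_nonneg_nonpos order_trans)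
  next
    case False
    then have "\<eta> / 2 * ?h \<theta> \<le> \<kappa> / 2 * ?h \<theta>" using \<eta> by (intro mult_right_mono) auto
    then show ?thesis using d(2) by linarith
  qed
  then have "\<eta> * (\<eta> / 2 * ?h \<theta>) \<le> \<eta> * differential A \<rho> x v"
    using \<eta>(1) by (intro mult_left_mono) auto
  then show ?thesis using eq x(2) by (simp add: power2_eq_square)
qed

end

theorem proposition2p13:
  fixes A :: "('m, 'e::real_inner) chart set"
    and g :: "('m, 'e) metric_tensor"
    and R :: "'m \<Rightarrow> ('m, 'e) tvec \<Rightarrow> 'm"
    and \<Omega> :: "'w set"
    and H :: "'m \<Rightarrow> 'w \<Rightarrow> ('m, 'e) tvec"
  assumes "riemannian_manifold A g"
    and "manifold_retraction A R"
    and "\<Omega> \<noteq> {}"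
    and "vector_field_family A \<Omega> H"
    and "locally_bounded A g \<Omega> H"
  shows
    "(\<forall>(\<rho> :: 'm \<Rightarrow> real) (\<rho>0 :: real) (\<rho>1 :: real) (\<gamma> :: nat \<Rightarrow> real) (l :: real) (b :: real)
       (\<Theta> :: real) (c :: real) (\<sigma> :: real) (\<phi> :: real) (x :: nat \<Rightarrow> 'm) (u :: nat \<Rightarrow> ('m, 'e) tvec).
        confinement A g \<Omega> H \<rho> \<and> confinement_level A g \<Omega> H \<rho> \<rho>0 \<and>
        (\<forall>t. \<gamma> t > 0) \<and> summable (\<lambda>t. (\<gamma> t)\<^sup>2) \<and>
        filterlim (\<lambda>n. \<Sum>t<n. \<gamma> t) at_top sequentially \<and>
        l > 0 \<and> b > 0 \<and> \<Theta> > 0 \<and>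
        c \<in> range \<gamma> \<and> (\<forall>t. \<gamma> t \<le> c) \<and>
        \<sigma> = (\<Sum>t. (\<gamma> t)\<^sup>2) \<and> \<rho>1 = \<rho>0 + l * c + b\<^sup>2 * \<sigma> / 2 \<and>
        \<phi> > 0 \<and>
        ereal \<phi> \<ge> max (max (Lambda_bound A g \<Omega> H \<rho> \<rho>0 l) (B_bound A R \<Omega> H \<rho> \<rho>1 \<Theta> b))
                       (ereal (c / \<Theta>)) \<and>
        (\<forall>t. x t \<in> points A) \<and> (\<forall>t. u t \<in> hull_at \<Omega> H (x t)) \<and>
        \<rho> (x 0) \<le> \<rho>0 \<and> (\<forall>t. x (Suc t) = R (x t) (- (\<gamma> t / \<phi>) *\<^sub>R u t))
        \<longrightarrow> compactin (manifold_topology A) (sublevel A \<rho> \<rho>1) \<and> (\<forall>t. x t \<in> sublevel A \<rho> \<rho>1))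
     \<and>
     (\<forall>(\<rho> :: 'm \<Rightarrow> real) (\<kappa> :: real) (\<rho>0 :: real) (\<rho>1 :: real) (\<eta> :: nat \<Rightarrow> real)
       (x :: nat \<Rightarrow> 'm) (u :: nat \<Rightarrow> ('m, 'e) tvec).
        \<kappa> > 0 \<and> batch_confinement A g R \<Omega> H \<kappa> \<rho> \<and>
        \<rho>0 < \<rho>1 \<and> batch_levels A g R \<Omega> H \<kappa> \<rho> \<rho>0 \<rho>1 \<and>
        (\<forall>t. 0 < \<eta> t \<and> \<eta> t \<le> \<kappa>) \<and>
        (\<forall>t. x t \<in> points A) \<and> (\<forall>t. u t \<in> hull_at \<Omega> H (x t)) \<and>
        \<rho> (x 0) \<le> \<rho>1 \<and> (\<forall>t. x (Suc t) = R (x t) (- \<eta> t *\<^sub>R u t))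
        \<longrightarrow> compactin (manifold_topology A) (sublevel A \<rho> \<rho>1) \<and> (\<forall>t. x t \<in> sublevel A \<rho> \<rho>1))"
proof (intro conjI allI impI; (elim conjE)?)
  interpret riemannian_manifold A g by fact
  note R = \<open>manifold_retraction A R\<close> and H = \<open>vector_field_family A \<Omega> H\<close>
  {
    fix \<rho> :: "'m \<Rightarrow> real" and \<rho>1
    assume "confinement A g \<Omega> H \<rho>"
    then show "compactin (manifold_topology A) (sublevel A \<rho> \<rho>1)"
      by (simp add: confinement_def)
  next
    fix \<rho> :: "'m \<Rightarrow> real" and \<rho>1 \<kappa>
    assume "batch_confinement A g R \<Omega> H \<kappa> \<rho>"
    then show "compactin (manifold_topology A) (sublevel A \<rho> \<rho>1)"
      by (simp add: batch_confinement_def)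
  next
    fix \<rho> :: "'m \<Rightarrow> real" and \<rho>0 \<rho>1 :: real and \<gamma> :: "nat \<Rightarrow> real" and l b \<Theta> c \<sigma> \<phi> :: real
      and x :: "nat \<Rightarrow> 'm" and u :: "nat \<Rightarrow> ('m, 'e) tvec" and t
    assume *: "confinement A g \<Omega> H \<rho>" "confinement_level A g \<Omega> H \<rho> \<rho>0" "\<forall>t. \<gamma> t > 0"
      "summable (\<lambda>t. (\<gamma> t)\<^sup>2)" "l > 0" "b > 0" "\<Theta> > 0" "\<forall>t. \<gamma> t \<le> c" "\<sigma> = (\<Sum>t. (\<gamma> t)\<^sup>2)"
      "\<rho>1 = \<rho>0 + l * c + b\<^sup>2 * \<sigma> / 2" "\<phi> > 0"
      "ereal \<phi> \<ge> max (max (Lambda_bound A g \<Omega> H \<rho> \<rho>0 l) (B_bound A R \<Omega> H \<rho> \<rho>1 \<Theta> b))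
        (ereal (c / \<Theta>))"
      "\<forall>t. x t \<in> points A" "\<forall>t. u t \<in> hull_at \<Omega> H (x t)" "\<rho> (x 0) \<le> \<rho>0"
      "\<forall>t. x (Suc t) = R (x t) (- (\<gamma> t / \<phi>) *\<^sub>R u t)"
    have "Ck_map 2 A standard_atlas \<rho>" using *(1) by (simp add: confinement_def)
    then have "\<rho> (x t) \<le> \<rho>1"
      by (rule confined_iterates[OF R _ H *(2), where \<gamma> = \<gamma> and u = u and l = l and b = b
            and \<Theta> = \<Theta> and c = c and \<phi> = \<phi>]) (use * in auto)
    then show "x t \<in> sublevel A \<rho> \<rho>1" using *(13) by (simp add: sublevel_def)
  next
    fix \<rho> :: "'m \<Rightarrow> real" and \<kappa> \<rho>0 \<rho>1 :: real and \<eta> :: "nat \<Rightarrow> real"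
      and x :: "nat \<Rightarrow> 'm" and u :: "nat \<Rightarrow> ('m, 'e) tvec" and t
    assume *: "batch_confinement A g R \<Omega> H \<kappa> \<rho>" "batch_levels A g R \<Omega> H \<kappa> \<rho> \<rho>0 \<rho>1"
      "\<forall>t. 0 < \<eta> t \<and> \<eta> t \<le> \<kappa>" "\<forall>t. x t \<in> points A" "\<forall>t. u t \<in> hull_at \<Omega> H (x t)"
      "\<rho> (x 0) \<le> \<rho>1" "\<forall>t. x (Suc t) = R (x t) (- \<eta> t *\<^sub>R u t)"
    have \<rho>: "Ck_map 2 A standard_atlas \<rho>" using *(1) by (simp add: batch_confinement_def)
    have "\<rho> (x t) \<le> \<rho>1"
    proof (induction t)
      case (Suc t)
      then show ?case
        using batch_confined_step[OF R \<rho> H *(2), of "\<eta> t" "x t" "u t"] *(3,4,5,7) by simp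
    qed (rule *(6))
    then show "x t \<in> sublevel A \<rho> \<rho>1" using *(4) by (simp add: sublevel_def)
  }
qed

end
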